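(* Let $X$ be a topological space. The operators $T_n^*:S_n(X)\to S_n(X)$, $f\mapsto f\circ T_n^{-1}$, on the singular chain groups satisfy the cyclic compatibility conditions $$d_0T_n^*=d_n,\qquad d_iT_n^*=T_{n-1}^*d_{i-1}\quad(1\le i\le n).$$
   Context: $\Delta_n=\{(t_0,\dots,t_n)\in\mathbb{R}^{n+1}: 0\le t_i\le1,\ \sum t_i=1\}$; $\delta_i:\Delta_{n-1}\to\Delta_n$, $(t_0,\dots,t_{n-1})\mapsto(t_0,\dots,t_{i-1},0,t_i,\dots,t_{n-1})$. $S_n(X)$ is the free abelian group on continuous maps $f:\Delta_n\to X$, and $d_i:S_n(X)\to S_{n-1}(X)$ is the linear map with $d_if=f\circ\delta_i$. $T_n:\Delta_n\to\Delta_n$ is $T_n(u_0,\dots,u_n)=(u_n,u_0,\dots,u_{n-1})$, and $T_n^*$ is the linear map with $T_n^*f=f\circ T_n^{-1}$ on singular simplices. *)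

theory Defs
  imports "HOL-Homology.Homology"
begin

text \<open>
  The points of \<^term>\<open>standard_simplex n\<close> are sequences that vanish beyond index \<open>n\<close>, so
  \<open>cyclic_rotation n\<close>, which maps \<open>(u\<^sub>0, \<dots>, u\<^sub>n)\<close> to \<open>(u\<^sub>n, u\<^sub>0, \<dots>, u\<^sub>n\<^sub>-\<^sub>1)\<close>, is extended by zero.
\<close>

definition cyclic_rotation :: "nat \<Rightarrow> (nat \<Rightarrow> real) \<Rightarrow> nat \<Rightarrow> real" where
  "cyclic_rotation n u \<equiv> \<lambda>i. if i = 0 then u n else if i \<le> n then u (i - 1) else 0"

text \<open>
  A singular simplex is required by \<^const>\<open>singular_simplex\<close> to be \<^const>\<open>undefined\<close> off the
  standard simplex, hence the \<^const>\<open>restrict\<close>, as in \<^const>\<open>singular_face\<close>.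
\<close>

definition singular_rotate :: "nat \<Rightarrow> ((nat \<Rightarrow> real) \<Rightarrow> 'a) \<Rightarrow> (nat \<Rightarrow> real) \<Rightarrow> 'a" where
  "singular_rotate n f \<equiv>
     restrict (f \<circ> inv_into (standard_simplex n) (cyclic_rotation n)) (standard_simplex n)"

definition chain_rotate :: "nat \<Rightarrow> 'a chain \<Rightarrow> 'a chain" where
  "chain_rotate n c \<equiv> frag_extend (frag_of \<circ> singular_rotate n) c"

text \<open>
  \<open>chain_face n i\<close> is the face operator \<open>d\<^sub>i\<close> from \<open>n\<close>-chains to \<open>(n - 1)\<close>-chains; it is meaningful
  for \<open>1 \<le> n\<close> and \<open>i \<le> n\<close>.
\<close>

definition chain_face :: "nat \<Rightarrow> nat \<Rightarrow> 'a chain \<Rightarrow> 'a chain" where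
  "chain_face n i c \<equiv> frag_extend (frag_of \<circ> singular_face n i) c"

lemma cyclic_rotation_in_standard_simplex:
  assumes "u \<in> standard_simplex n"
  shows "cyclic_rotation n u \<in> standard_simplex n"
proof -
  have "(\<Sum>i\<le>n. cyclic_rotation n u i) = (\<Sum>i\<le>n. u i)"
  proof (cases n)
    case (Suc m)
    have "(\<Sum>i\<le>n. cyclic_rotation n u i)
        = cyclic_rotation n u 0 + (\<Sum>i\<le>m. cyclic_rotation n u (Suc i))"
      unfolding Suc by (rule sum.atMost_Suc_shift)
    also have "\<dots> = u n + (\<Sum>i\<le>m. u i)"
      by (simp add: cyclic_rotation_def Suc)
    finally show ?thesis
      by (simp add: Suc)
  qed (simp add: cyclic_rotation_def)
  with assms show ?thesis
    by (auto simp: standard_simplex_def cyclic_rotation_def)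
qed

lemma bij_betw_cyclic_rotation:
  "bij_betw (cyclic_rotation n) (standard_simplex n) (standard_simplex n)"
  and inv_into_cyclic_rotation:
  "\<And>v. v \<in> standard_simplex n \<Longrightarrow> inv_into (standard_simplex n) (cyclic_rotation n) v =
     (\<lambda>i. if i < n then v (Suc i) else if i = n then v 0 else 0)"
proof -
  define R :: "(nat \<Rightarrow> real) \<Rightarrow> nat \<Rightarrow> real"
    where "R = (\<lambda>v i. if i < n then v (Suc i) else if i = n then v 0 else 0)"
  have R: "R v \<in> standard_simplex n" if "v \<in> standard_simplex n" for v
  proof -
    have "(\<Sum>i\<le>n. R v i) = (\<Sum>i\<le>n. v i)"
    proof (cases n)
      case (Suc m)
      have "(\<Sum>i\<le>n. R v i) = v 0 + (\<Sum>i\<le>m. v (Suc i))"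
        by (simp add: R_def Suc)
      also have "\<dots> = (\<Sum>i\<le>n. v i)"
        unfolding Suc by (rule sum.atMost_Suc_shift [symmetric])
      finally show ?thesis .
    qed (simp add: R_def)
    with that show ?thesis
      by (auto simp: standard_simplex_def R_def)
  qed
  have RT: "R (cyclic_rotation n u) = u" if "u \<in> standard_simplex n" for u
    using that by (auto simp: standard_simplex_def R_def cyclic_rotation_def fun_eq_iff)
  have TR: "cyclic_rotation n (R v) = v" if "v \<in> standard_simplex n" for v
    using that by (auto simp: standard_simplex_def R_def cyclic_rotation_def fun_eq_iff)
  show bij: "bij_betw (cyclic_rotation n) (standard_simplex n) (standard_simplex n)"
    by (rule bij_betw_byWitness [where f' = R])
      (use R RT TR cyclic_rotation_in_standard_simplex in auto)
  show "inv_into (standard_simplex n) (cyclic_rotation n) v =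
     (\<lambda>i. if i < n then v (Suc i) else if i = n then v 0 else 0)"
    if "v \<in> standard_simplex n" for v
    using inv_into_f_eq [where f = "cyclic_rotation n", OF bij_betw_imp_inj_on [OF bij] R [OF that] TR [OF that]]
    by (simp add: R_def)
qed

lemma singular_simplex_singular_rotate:
  assumes "singular_simplex n X f"
  shows "singular_simplex n X (singular_rotate n f)"
proof -
  let ?S = "subtopology (powertop_real UNIV) (standard_simplex n)"
  let ?R = "\<lambda>v i. if i < n then v (Suc i) else if i = n then v 0 else (0::real)"
  let ?I = "inv_into (standard_simplex n) (cyclic_rotation n)"
  have "continuous_map (powertop_real UNIV) euclideanreal (\<lambda>v. ?R v i)" for i
    by (auto intro: continuous_map_product_projection)
  then have "continuous_map ?S (powertop_real UNIV) ?R"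
    by (simp add: continuous_map_componentwise continuous_map_from_subtopology)
  then have "continuous_map ?S (powertop_real UNIV) ?I"
    by (rule continuous_map_eq) (simp add: inv_into_cyclic_rotation)
  moreover have "?I v \<in> standard_simplex n" if "v \<in> standard_simplex n" for v
    using that bij_betw_cyclic_rotation [of n] by (metis bij_betw_def inv_into_into)
  ultimately have "continuous_map ?S ?S ?I"
    by (auto simp: continuous_map_in_subtopology)
  from continuous_map_compose [OF this] assms show ?thesis
    by (auto simp: singular_simplex_def singular_rotate_def)
qed

lemma chain_rotate_hom: "chain_rotate n \<in> hom (chain_group n X) (chain_group n X)"
proof (rule homI)
  show "chain_rotate n c \<in> carrier (chain_group n X)" if "c \<in> carrier (chain_group n X)" for c
    using that unfolding chain_rotate_def
    by (auto intro!: singular_chain_extend simp: singular_chain_of)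
      (auto simp: singular_chain_def intro: singular_simplex_singular_rotate)
qed (simp add: chain_rotate_def frag_extend_add)

lemma chain_face_hom:
  assumes "1 \<le> n" "i \<le> n"
  shows "chain_face n i \<in> hom (chain_group n X) (chain_group (n - 1) X)"
proof (rule homI)
  show "chain_face n i c \<in> carrier (chain_group (n - 1) X)"
    if "c \<in> carrier (chain_group n X)" for c
    using that assms unfolding chain_face_def
    by (auto intro!: singular_chain_extend simp: singular_chain_of)
      (auto simp: singular_chain_def intro: singular_simplex_singular_face)
qed (simp add: chain_face_def frag_extend_add)

end

theory Submission
  imports Defs
begin

text \<open>Precomposition turns each claim into an identity of maps of simplices. The inverse
  rotation sends (v_0,...,v_n) to (v_1,...,v_n,v_0), so a zero inserted at position 0 moves to the
  end, and one inserted at i >= 1 moves to i - 1 while v_0 goes last. Hence T_n^{-1} o delta_0 =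
  delta_n (\<open>inv_cyclic_rotation_simplical_face_0\<close>) and T_n^{-1} o delta_i = delta_{i-1}
  o T_{n-1}^{-1} (\<open>inv_cyclic_rotation_simplical_face\<close>). Composing with f and extending
  linearly gives the result.\<close>

lemma inv_cyclic_rotation_simplical_face_0:
  assumes "1 \<le> n" "v \<in> standard_simplex (n - 1)"
  shows "inv_into (standard_simplex n) (cyclic_rotation n) (simplical_face 0 v) = simplical_face n v"
proof -
  have "simplical_face 0 v \<in> standard_simplex n"
    using assms simplical_face_in_standard_simplex [of n 0 v] by simp
  \<comment> \<open>At an index j > n, \<open>simplical_face n v\<close> reads
    \<open>v (j - 1)\<close>, whereas the inverse rotation gives 0.\<close>
  moreover have "v j = 0" if "n \<le> j" for j
    using that assms by (auto simp: standard_simplex_def)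
  ultimately show ?thesis
    by (auto simp: inv_into_cyclic_rotation simplical_face_def fun_eq_iff)
qed

text \<open>Both sides are (v_1,...,v_{i-1},0,v_i,...,v_{n-1},v_0).\<close>

lemma inv_cyclic_rotation_simplical_face:
  assumes "1 \<le> i" "i \<le> n" "v \<in> standard_simplex (n - 1)"
  shows "inv_into (standard_simplex n) (cyclic_rotation n) (simplical_face i v) =
    simplical_face (i - 1) (inv_into (standard_simplex (n - 1)) (cyclic_rotation (n - 1)) v)"
proof -
  have "simplical_face i v \<in> standard_simplex n"
    using assms simplical_face_in_standard_simplex [of n i v] by simp
  \<comment> \<open>Past the inserted zero, the right side compares \<open>j - 1\<close> with
    \<open>n - 1\<close>; as j and n are positive, truncated subtraction does no harm.\<close>
  moreover have "j - 1 = n - 1 \<longleftrightarrow> j = n" "j - 1 < n - 1 \<longleftrightarrow> j < n" if "i - 1 < j" for j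
    using that assms by linarith+
  ultimately show ?thesis
    using assms by (auto simp: inv_into_cyclic_rotation simplical_face_def fun_eq_iff)
qed

lemma singular_face_0_singular_rotate:
  assumes "1 \<le> n"
  shows "singular_face n 0 (singular_rotate n f) = singular_face n n f"
  using assms simplical_face_in_standard_simplex [of n 0]
  by (auto simp: singular_face_def singular_rotate_def fun_eq_iff
      inv_cyclic_rotation_simplical_face_0 restrict_def)

lemma singular_face_singular_rotate:
  assumes "1 \<le> i" "i \<le> n"
  shows "singular_face n i (singular_rotate n f) =
    singular_rotate (n - 1) (singular_face n (i - 1) f)"
proof -
  \<comment> \<open>The inner \<open>restrict\<close>, from \<open>singular_face\<close>, is thus
    never evaluated where it is \<open>undefined\<close>.\<close>
  have "inv_into (standard_simplex (n - 1)) (cyclic_rotation (n - 1)) v \<in> standard_simplex (n - 1)"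
    if "v \<in> standard_simplex (n - 1)" for v
    using that bij_betw_cyclic_rotation [of "n - 1"] by (metis bij_betw_def inv_into_into)
  then show ?thesis
    using assms simplical_face_in_standard_simplex [of n i]
    by (auto simp: singular_face_def singular_rotate_def fun_eq_iff
        inv_cyclic_rotation_simplical_face restrict_def)
qed

theorem proposition3p2:
  fixes X :: "'a topology" and n :: nat
  assumes "n \<ge> 1"
  shows "(\<forall>c\<in>carrier (chain_group n X).
            chain_face n 0 (chain_rotate n c) = chain_face n n c) \<and>
         (\<forall>i\<in>{1..n}. \<forall>c\<in>carrier (chain_group n X).
            chain_face n i (chain_rotate n c) = chain_rotate (n - 1) (chain_face n (i - 1) c))"
  \<comment> \<open>Composites of linear extensions are linear extensions of composites, so it
    suffices to compare values on generators.\<close>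
  using assms
  by (auto simp: chain_face_def chain_rotate_def frag_extend_compose singular_face_0_singular_rotate
      singular_face_singular_rotate intro!: frag_extend_eq)

end
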